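(* Let $\mathcal{G}=(B,\Delta_B)$ be a compact quantum group and let $\Psi_B:M_2\to M_2\otimes B$ be a continuous action of $\mathcal{G}$ on $M_2$ preserving the state $\omega_0$. Then there exists a unique unital $*$-homomorphism $\Gamma:\mathrm{C}(\mathbb{T})\to B$ such that $$(\mathrm{id}_{M_2}\otimes\Gamma)\circ\Psi_0=\Psi_B.$$
   Context: All $\mathrm{C}^*$-algebras are unital. $M_2$ is the $\mathrm{C}^*$-algebra of $2\times 2$ complex matrices, generated by $\boldsymbol{n}=\begin{bmatrix}0&1\\0&0\end{bmatrix}$; elements of $M_2\otimes B$ are written as $2\times2$ matrices over $B$. The state $\omega_0$ on $M_2$ is $\omega_0(m)=m_{1,1}$ for $m=(m_{i,j})$. A compact quantum group (in the sense of Woronowicz) is a pair $(B,\Delta_B)$ of a unital $\mathrm{C}^*$-algebra and a coassociative comultiplication $\Delta_B:B\to B\otimes B$ satisfying the usual density conditions. An action of $(B,\Delta_B)$ on $M_2$ is a unital $*$-homomorphism $\Psi_B:M_2\to M_2\otimes B$ with $(\Psi_B\otimes\mathrm{id}_B)\circ\Psi_B=(\mathrm{id}_{M_2}\otimes\Delta_B)\circ\Psi_B$. It is continuous if $\{\Psi_B(m)(\mathbb{1}\otimes b): m\in M_2,\ b\in B\}$ is linearly dense in $M_2\otimes B$. It preserves $\omega_0$ if $(\omega_0\otimes\mathrm{id}_B)\Psi_B(m)=\omega_0(m)\mathbb{1}$ for all $m\in M_2$. $\mathbb{T}$ is the circle group, $\boldsymbol{u}\in\mathrm{C}(\mathbb{T})$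 is the standard unitary generator (the identity function), and $\Psi_0:M_2\to M_2\otimes\mathrm{C}(\mathbb{T})$ is the action of $\mathbb{T}$ on $M_2$ determined by $\Psi_0(\boldsymbol{n})=\begin{bmatrix}0&\boldsymbol{u}\\0&0\end{bmatrix}$. *)

theory Defs
  imports "HOL-Analysis.Analysis"
begin

section \<open>Unital C*-algebras\<close>

text \<open>
  As usual in the unital theory the zero algebra is not admitted (it carries no state, hence no
  Haar state): \<^class>\<open>real_normed_algebra_1\<close> includes \<open>0 \<noteq> 1\<close>.
\<close>

class unital_cstar_algebra = real_normed_algebra_1 + banach +
  fixes scaleC :: "complex \<Rightarrow> 'a \<Rightarrow> 'a" (infixr \<open>*\<^sub>C\<close> 75)
    and adj :: "'a \<Rightarrow> 'a"
  assumes scaleC_add_right: "c *\<^sub>C (x + y) = c *\<^sub>C x + c *\<^sub>C y"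
    and scaleC_add_left: "(c + d) *\<^sub>C x = c *\<^sub>C x + d *\<^sub>C x"
    and scaleC_scaleC: "c *\<^sub>C d *\<^sub>C x = (c * d) *\<^sub>C x"
    and scaleR_scaleC: "r *\<^sub>R x = complex_of_real r *\<^sub>C x"
    and mult_scaleC_left: "(c *\<^sub>C x) * y = c *\<^sub>C (x * y)"
    and mult_scaleC_right: "x * (c *\<^sub>C y) = c *\<^sub>C (x * y)"
    and norm_scaleC: "norm (c *\<^sub>C x) = cmod c * norm x"
    and adj_add: "adj (x + y) = adj x + adj y"
    and adj_scaleC: "adj (c *\<^sub>C x) = cnj c *\<^sub>C adj x"
    and adj_mult: "adj (x * y) = adj y * adj x"
    and adj_adj: "adj (adj x) = x"
    and cstar_identity: "norm (adj x * x) = (norm x)\<^sup>2"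

definition unital_star_hom ::
    "('a::unital_cstar_algebra \<Rightarrow> 'b::unital_cstar_algebra) \<Rightarrow> bool" where
  "unital_star_hom f \<longleftrightarrow>
     (\<forall>x y. f (x + y) = f x + f y) \<and>
     (\<forall>c x. f (c *\<^sub>C x) = c *\<^sub>C f x) \<and>
     (\<forall>x y. f (x * y) = f x * f y) \<and>
     (\<forall>x. f (adj x) = adj (f x)) \<and>
     f 1 = 1"

definition is_state :: "('a::unital_cstar_algebra \<Rightarrow> complex) \<Rightarrow> bool" where
  "is_state \<phi> \<longleftrightarrow>
     (\<forall>x y. \<phi> (x + y) = \<phi> x + \<phi> y) \<and>
     (\<forall>c x. \<phi> (c *\<^sub>C x) = c * \<phi> x) \<and>
     (\<forall>x. \<phi> (adj x * x) \<in> \<real>\<^sub>\<ge>\<^sub>0) \<and>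
     \<phi> 1 = 1"

instantiation complex :: unital_cstar_algebra
begin

definition scaleC_complex :: "complex \<Rightarrow> complex \<Rightarrow> complex" where
  "scaleC_complex c x = c * x"

definition adj_complex :: "complex \<Rightarrow> complex" where
  "adj_complex = cnj"

instance
  by standard
    (simp_all add: scaleC_complex_def adj_complex_def algebra_simps norm_mult
      scaleR_conv_of_real power2_eq_square)

end


section \<open>The algebra of continuous functions on the circle\<close>

text \<open>
  The library type of bounded continuous functions is a C*-algebra under the pointwise operations
  and the supremum norm. Over a compact domain it consists of all continuous functions.
\<close>

setup_lifting type_definition_bcontfun

lemma bcontfun_mult:
  fixes f g :: "'a::topological_space \<Rightarrow> 'b::real_normed_algebra"
  assumes "f \<in> bcontfun" "g \<in> bcontfun"
  shows "(\<lambda>x. f x * g x) \<in> bcontfun"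
proof -
  obtain B where B: "\<And>x. norm (f x) \<le> B"
    using assms(1) by (auto simp: bcontfun_def bounded_iff)
  obtain C where C: "\<And>x. norm (g x) \<le> C"
    using assms(2) by (auto simp: bcontfun_def bounded_iff)
  show ?thesis
  proof (rule bcontfun_normI)
    show "continuous_on UNIV (\<lambda>x. f x * g x)"
      using assms by (auto simp: bcontfun_def intro!: continuous_on_mult)
    show "norm (f x * g x) \<le> B * C" for x
      using norm_mult_ineq[of "f x" "g x"]
        mult_mono[OF B[of x] C[of x] order_trans[OF norm_ge_zero B[of x]] norm_ge_zero]
      by linarith
  qed
qed

lemma bounded_linear_scaleC: "bounded_linear (\<lambda>x. c *\<^sub>C x)"
proof (rule bounded_linear_intro[where K = "cmod c"])
  show "c *\<^sub>C (x + y) = c *\<^sub>C x + c *\<^sub>C y" for x y :: 'a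
    by (rule scaleC_add_right)
  show "c *\<^sub>C (r *\<^sub>R x) = r *\<^sub>R (c *\<^sub>C x)" for r and x :: 'a
    by (simp add: scaleR_scaleC scaleC_scaleC mult.commute)
  show "norm (c *\<^sub>C x) \<le> norm x * cmod c" for x :: 'a
    by (simp add: norm_scaleC)
qed

lemma norm_adj [simp]: "norm (adj x) = norm (x :: 'a::unital_cstar_algebra)"
proof -
  have *: "norm y \<le> norm (adj y)" for y :: 'a
  proof (cases "y = 0")
    case False
    have "norm y * norm y \<le> norm (adj y) * norm y"
      using cstar_identity[of y] norm_mult_ineq[of "adj y" y] by (simp add: power2_eq_square)
    with False show ?thesis by simp
  qed simp
  show ?thesis using *[of x] *[of "adj x"] by (simp add: adj_adj)
qed

lemma adj_scaleR: "adj (r *\<^sub>R x) = r *\<^sub>R adj x"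
  by (simp add: scaleR_scaleC adj_scaleC)

lemma adj_one [simp]: "adj 1 = (1 :: 'a::unital_cstar_algebra)"
  by (metis adj_adj adj_mult mult.right_neutral mult.left_neutral)

lemma bounded_linear_adj: "bounded_linear adj"
  by (rule bounded_linear_intro[where K = 1]) (simp_all add: adj_add adj_scaleR)

lemma bcontfun_bounded_linear:
  assumes "bounded_linear h" "f \<in> bcontfun"
  shows "(\<lambda>x. h (f x)) \<in> bcontfun"
proof -
  interpret bounded_linear h by fact
  show ?thesis
    using assms(2) bounded_linear_image[OF _ assms(1), of "range f"]
    by (auto simp: bcontfun_def image_image intro: continuous_on)
qed

instantiation bcontfun :: (metric_space, unital_cstar_algebra) unital_cstar_algebra
begin

lift_definition one_bcontfun :: "'a \<Rightarrow>\<^sub>C 'b" is "\<lambda>_. 1"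
  by (rule const_bcontfun)

lift_definition times_bcontfun :: "('a \<Rightarrow>\<^sub>C 'b) \<Rightarrow> ('a \<Rightarrow>\<^sub>C 'b) \<Rightarrow> 'a \<Rightarrow>\<^sub>C 'b" is "\<lambda>f g x. f x * g x"
  by (rule bcontfun_mult)

lift_definition scaleC_bcontfun :: "complex \<Rightarrow> ('a \<Rightarrow>\<^sub>C 'b) \<Rightarrow> 'a \<Rightarrow>\<^sub>C 'b" is "\<lambda>c f x. c *\<^sub>C f x"
  by (rule bcontfun_bounded_linear[OF bounded_linear_scaleC])

lift_definition adj_bcontfun :: "('a \<Rightarrow>\<^sub>C 'b) \<Rightarrow> 'a \<Rightarrow>\<^sub>C 'b" is "\<lambda>f x. adj (f x)"
  by (rule bcontfun_bounded_linear[OF bounded_linear_adj])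

lemmas bcontfun_apply [simp] =
  one_bcontfun.rep_eq times_bcontfun.rep_eq scaleC_bcontfun.rep_eq adj_bcontfun.rep_eq

instance
proof
  fix f g h :: "'a \<Rightarrow>\<^sub>C 'b" and r :: real and c d :: complex
  show "f * g * h = f * (g * h)"
    by (rule bcontfun_eqI) (simp add: mult.assoc)
  show "(f + g) * h = f * h + g * h" "f * (g + h) = f * g + f * h"
    by (rule bcontfun_eqI, simp add: algebra_simps)+
  show "1 * f = f" "f * 1 = f"
    by (rule bcontfun_eqI, simp)+
  have "apply_bcontfun 0 x \<noteq> apply_bcontfun (1 :: 'a \<Rightarrow>\<^sub>C 'b) x" for x :: 'a
    by simp
  then show "(0 :: 'a \<Rightarrow>\<^sub>C 'b) \<noteq> 1"
    by metis
  show "(r *\<^sub>R f) * g = r *\<^sub>R (f * g)" "f * (r *\<^sub>R g) = r *\<^sub>R (f * g)"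
    by (rule bcontfun_eqI, simp)+
  show "norm (f * g) \<le> norm f * norm g"
  proof (rule norm_bound)
    show "norm (apply_bcontfun (f * g) x) \<le> norm f * norm g" for x
      using norm_mult_ineq[of "apply_bcontfun f x" "apply_bcontfun g x"]
        mult_mono[OF norm_bounded[of f x] norm_bounded[of g x] norm_ge_zero norm_ge_zero]
      by simp
  qed
  show "norm (1 :: 'a \<Rightarrow>\<^sub>C 'b) = 1"
  proof (rule antisym)
    show "norm (1 :: 'a \<Rightarrow>\<^sub>C 'b) \<le> 1" by (rule norm_bound) simp
    show "1 \<le> norm (1 :: 'a \<Rightarrow>\<^sub>C 'b)"
      using norm_bounded[of "1 :: 'a \<Rightarrow>\<^sub>C 'b" undefined] by simp
  qed
  show "c *\<^sub>C (f + g) = c *\<^sub>C f + c *\<^sub>C g" "(c + d) *\<^sub>C f = c *\<^sub>C f + d *\<^sub>C f"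
    "c *\<^sub>C d *\<^sub>C f = (c * d) *\<^sub>C f" "r *\<^sub>R f = complex_of_real r *\<^sub>C f"
    "(c *\<^sub>C f) * g = c *\<^sub>C (f * g)" "f * (c *\<^sub>C g) = c *\<^sub>C (f * g)"
    "adj (f + g) = adj f + adj g" "adj (c *\<^sub>C f) = cnj c *\<^sub>C adj f"
    "adj (f * g) = adj g * adj f" "adj (adj f) = f"
    by (rule bcontfun_eqI, simp add: scaleC_add_right scaleC_add_left scaleC_scaleC scaleR_scaleC
        mult_scaleC_left mult_scaleC_right adj_add adj_scaleC adj_mult adj_adj)+
  have scaleC_le: "norm (a *\<^sub>C k) \<le> cmod a * norm k" for a and k :: "'a \<Rightarrow>\<^sub>C 'b"
    by (rule norm_bound) (simp add: norm_scaleC norm_bounded mult_left_mono)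
  show "norm (c *\<^sub>C f) = cmod c * norm f"
  proof (cases "c = 0")
    case True
    then show ?thesis using scaleC_le[of c f] by simp
  next
    case False
    have "f = inverse c *\<^sub>C c *\<^sub>C f"
      by (rule bcontfun_eqI)
        (use False scaleR_scaleC[of 1 "apply_bcontfun f _"] in \<open>simp add: scaleC_scaleC\<close>)
    then have "norm f \<le> inverse (cmod c) * norm (c *\<^sub>C f)"
      using scaleC_le[of "inverse c" "c *\<^sub>C f"] by (simp add: norm_inverse)
    with False have "cmod c * norm f \<le> norm (c *\<^sub>C f)"
      by (simp add: field_simps)
    with scaleC_le[of c f] show ?thesis by simp
  qed
  show "norm (adj f * f) = (norm f)\<^sup>2"
  proof (rule antisym)
    show "norm (adj f * f) \<le> (norm f)\<^sup>2"
      by (rule norm_bound) (simp add: cstar_identity power_mono norm_bounded)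
    have "norm (apply_bcontfun f x) \<le> sqrt (norm (adj f * f))" for x
      using norm_bounded[of "adj f * f" x] by (simp add: cstar_identity real_le_rsqrt)
    then have "norm f \<le> sqrt (norm (adj f * f))"
      by (rule norm_bound)
    then show "(norm f)\<^sup>2 \<le> norm (adj f * f)"
      using power_mono[of "norm f" "sqrt (norm (adj f * f))" 2] by simp
  qed
qed

end

typedef circle = "sphere (0::complex) 1"
  morphisms of_circle Abs_circle
  by (rule exI[of _ 1]) simp

instantiation circle :: metric_space
begin

definition dist_circle :: "circle \<Rightarrow> circle \<Rightarrow> real" where
  "dist_circle x y = dist (of_circle x) (of_circle y)"

definition uniformity_circle :: "(circle \<times> circle) filter" where
  "uniformity_circle = (INF e\<in>{0 <..}. principal {(x, y). dist x y < e})"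

definition open_circle :: "circle set \<Rightarrow> bool" where
  "open_circle U \<longleftrightarrow> (\<forall>x\<in>U. eventually (\<lambda>(x', y). x' = x \<longrightarrow> y \<in> U) uniformity)"

instance
  by standard
    (simp_all add: dist_circle_def uniformity_circle_def open_circle_def of_circle_inject
      dist_triangle2)

end

lemma bcontfun_of_circle: "of_circle \<in> bcontfun"
proof (rule bcontfun_normI)
  show "continuous_on UNIV of_circle"
    by (auto simp: continuous_on_iff dist_circle_def)
  show "norm (of_circle x) \<le> 1" for x
    using of_circle[of x] by simp
qed

lift_definition circle_gen :: "circle \<Rightarrow>\<^sub>C complex" is of_circle
  by (rule bcontfun_of_circle)


section \<open>Two by two matrices\<close>

text \<open>
  The tensor product of the matrix algebra with \<open>B\<close> is rendered by the type \<^typ>\<open>'b^2^2\<close> of matrices over \<open>B\<close>, with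
  matrix product, conjugate transpose and entrywise convergence. Its C*-norm, which is not the
  library norm of \<^typ>\<open>'b^2^2\<close> but is equivalent to it, is never needed.
\<close>

definition madj :: "'b::unital_cstar_algebra^2^2 \<Rightarrow> 'b^2^2" where
  "madj A = (\<chi> i j. adj (A $ j $ i))"

definition unital_star_hom_mat2 ::
    "('a::unital_cstar_algebra^2^2 \<Rightarrow> 'b::unital_cstar_algebra^2^2) \<Rightarrow> bool" where
  "unital_star_hom_mat2 F \<longleftrightarrow>
     (\<forall>A B. F (A + B) = F A + F B) \<and>
     (\<forall>c A. F (map_matrix (scaleC c) A) = map_matrix (scaleC c) (F A)) \<and>
     (\<forall>A B. F (A ** B) = F A ** F B) \<and>
     (\<forall>A. F (madj A) = madj (F A)) \<and>
     F (mat 1) = mat 1"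

abbreviation mat2 :: "'a::zero \<Rightarrow> 'a \<Rightarrow> 'a \<Rightarrow> 'a \<Rightarrow> 'a^2^2" where
  "mat2 a b c d \<equiv> vector [vector [a, b], vector [c, d]]"

definition mat_unit :: "2 \<Rightarrow> 2 \<Rightarrow> complex^2^2" where
  "mat_unit i j = axis i (axis j 1)"

definition nil_gen :: "complex^2^2" where
  "nil_gen = mat2 0 1 0 0"

definition \<omega>0 :: "complex^2^2 \<Rightarrow> complex" where
  "\<omega>0 m = m $ 1 $ 1"

text \<open>The map \<open>\<omega> \<otimes> id\<close>, using that a matrix \<open>A\<close> over \<open>B\<close> is the sum of the \<open>e\<^sub>i\<^sub>j \<otimes> A\<^sub>i\<^sub>j\<close>.\<close>

definition slice :: "(complex^2^2 \<Rightarrow> complex) \<Rightarrow> 'b::unital_cstar_algebra^2^2 \<Rightarrow> 'b" where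
  "slice \<omega> A = (\<Sum>i\<in>UNIV. \<Sum>j\<in>UNIV. \<omega> (mat_unit i j) *\<^sub>C A $ i $ j)"

definition \<Psi>0 :: "complex^2^2 \<Rightarrow> (circle \<Rightarrow>\<^sub>C complex)^2^2" where
  "\<Psi>0 m = mat2 (m $ 1 $ 1 *\<^sub>C 1) (m $ 1 $ 2 *\<^sub>C circle_gen)
               (m $ 2 $ 1 *\<^sub>C adj circle_gen) (m $ 2 $ 2 *\<^sub>C 1)"

lemma mat2_eq_iff:
  "A = B \<longleftrightarrow> A $ 1 $ 1 = B $ 1 $ 1 \<and> A $ 1 $ 2 = B $ 1 $ 2 \<and> A $ 2 $ 1 = B $ 2 $ 1 \<and>
     A $ 2 $ 2 = B $ 2 $ 2" for A B :: "'a^2^2"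
  by (auto simp: vec_eq_iff forall_2)

lemma circle_gen_unitary [simp]:
  "circle_gen * adj circle_gen = 1" "adj circle_gen * circle_gen = 1"
proof -
  have "of_circle x * cnj (of_circle x) = 1" for x
    using of_circle[of x] by (simp add: complex_mult_cnj cmod_def real_sqrt_eq_1_iff)
  then show "circle_gen * adj circle_gen = 1" "adj circle_gen * circle_gen = 1"
    by (auto intro!: bcontfun_eqI simp: circle_gen.rep_eq adj_complex_def mult.commute)
qed

lemma scaleC_one: "1 *\<^sub>C x = x"
  using scaleR_scaleC[of 1 x] by simp

lemma scaleC_zero_left: "0 *\<^sub>C x = 0"
  using scaleR_scaleC[of 0 x] by simp

lemma unital_star_hom_mat2_\<Psi>0: "unital_star_hom_mat2 \<Psi>0"
  unfolding unital_star_hom_mat2_def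
  by (auto simp: mat2_eq_iff \<Psi>0_def madj_def matrix_matrix_mult_def sum_2 mat_def
      scaleC_add_left scaleC_add_right scaleC_scaleC mult_scaleC_left mult_scaleC_right
      adj_scaleC adj_adj scaleC_one scaleC_zero_left scaleC_complex_def adj_complex_def
      mult.commute)

lemma \<Psi>0_nil_gen: "\<Psi>0 nil_gen = mat2 0 circle_gen 0 0"
  by (simp add: \<Psi>0_def nil_gen_def scaleC_one scaleC_zero_left)

text \<open>\<open>\<Psi>0\<close> is indeed determined by its value on the generator.\<close>

lemma \<Psi>0_unique:
  assumes F: "unital_star_hom_mat2 F" and "F nil_gen = mat2 0 circle_gen 0 0"
  shows "F = \<Psi>0"
proof
  fix m
  let ?s = "\<lambda>c. map_matrix (scaleC c) :: complex^2^2 \<Rightarrow> complex^2^2"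
  let ?n = nil_gen
  have m: "m = ?s (m$1$1) (?n ** madj ?n) + ?s (m$1$2) ?n
             + ?s (m$2$1) (madj ?n) + ?s (m$2$2) (madj ?n ** ?n)"
    by (simp add: mat2_eq_iff nil_gen_def madj_def matrix_matrix_mult_def sum_2
        scaleC_complex_def adj_complex_def)
  have "F ?n = \<Psi>0 ?n"
    using assms(2) by (simp add: \<Psi>0_nil_gen)
  then show "F m = \<Psi>0 m"
    using F unital_star_hom_mat2_\<Psi>0 unfolding unital_star_hom_mat2_def
    by (subst (1 2) m) presburger
qed


section \<open>Spatial tensor products\<close>

text \<open>
  Lists of pairs stand for elements of the algebraic tensor product: \<open>[(a\<^sub>1, b\<^sub>1), \<dots>]\<close> for
  \<open>a\<^sub>1 \<otimes> b\<^sub>1 + \<dots>\<close>.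
\<close>

definition formal_mult :: "('a::times \<times> 'b::times) list \<Rightarrow> ('a \<times> 'b) list \<Rightarrow> ('a \<times> 'b) list" where
  "formal_mult s t = concat (map (\<lambda>(a, b). map (\<lambda>(c, d). (a * c, b * d)) t) s)"

definition formal_adj ::
    "('a::unital_cstar_algebra \<times> 'b::unital_cstar_algebra) list \<Rightarrow> ('a \<times> 'b) list" where
  "formal_adj s = map (\<lambda>(a, b). (adj a, adj b)) s"

definition product_state :: "('a \<Rightarrow> complex) \<Rightarrow> ('b \<Rightarrow> complex) \<Rightarrow> ('a \<times> 'b) list \<Rightarrow> complex" where
  "product_state \<phi> \<psi> s = (\<Sum>(a, b)\<leftarrow>s. \<phi> a * \<psi> b)"

text \<open>
  The spatial norm is the supremum of \<open>\<parallel>(\<pi>\<^sub>\<phi> \<otimes> \<pi>\<^sub>\<psi>)(s)\<parallel>\<close> over the GNS representations of all pairs of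
  states. The vectors \<open>(\<pi>\<^sub>\<phi> \<otimes> \<pi>\<^sub>\<psi>)(y)(\<xi>\<^sub>\<phi> \<otimes> \<xi>\<^sub>\<psi>)\<close>, with \<open>y\<close> in the algebraic tensor product, are dense in the
  tensor product of the two GNS spaces, and the squared norm of such a vector is
  \<open>(\<phi> \<otimes> \<psi>)(y\<^sup>*y)\<close>.
\<close>

definition spatial_norm ::
    "('a::unital_cstar_algebra \<times> 'b::unital_cstar_algebra) list \<Rightarrow> real" where
  "spatial_norm s =
     Sup {sqrt (Re (product_state \<phi> \<psi>
            (formal_mult (formal_adj (formal_mult s y)) (formal_mult s y)))) | \<phi> \<psi> y.
          is_state \<phi> \<and> is_state \<psi> \<and> product_state \<phi> \<psi> (formal_mult (formal_adj y) y) = 1}"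

text \<open>
  The C*-algebra \<^typ>\<open>'c\<close>, together with \<open>(a, b) \<mapsto> a \<otimes> b\<close>, is the minimal (spatial) tensor
  product of \<^typ>\<open>'a\<close> and \<^typ>\<open>'b\<close>, i.e. the completion of the algebraic tensor product in
  the spatial norm. This determines it up to a unique isomorphism respecting \<open>\<otimes>\<close>.
\<close>

definition is_spatial_tensor ::
    "('a::unital_cstar_algebra \<Rightarrow> 'b::unital_cstar_algebra \<Rightarrow> 'c::unital_cstar_algebra) \<Rightarrow> bool"
where
  "is_spatial_tensor ten \<longleftrightarrow>
     (\<forall>a a' b. ten (a + a') b = ten a b + ten a' b) \<and>
     (\<forall>a b b'. ten a (b + b') = ten a b + ten a b') \<and>
     (\<forall>c a b. ten (c *\<^sub>C a) b = c *\<^sub>C ten a b) \<and>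
     (\<forall>c a b. ten a (c *\<^sub>C b) = c *\<^sub>C ten a b) \<and>
     (\<forall>a a' b b'. ten a b * ten a' b' = ten (a * a') (b * b')) \<and>
     (\<forall>a b. adj (ten a b) = ten (adj a) (adj b)) \<and>
     ten 1 1 = 1 \<and>
     (\<forall>s. norm (\<Sum>(a, b)\<leftarrow>s. ten a b) = spatial_norm s) \<and>
     closure (range (\<lambda>s. \<Sum>(a, b)\<leftarrow>s. ten a b)) = UNIV"


section \<open>Compact quantum groups and their actions on two by two matrices\<close>

text \<open>
  Here \<open>ten\<close>, \<open>tenL\<close> and \<open>tenR\<close> are the maps \<open>(a, b) \<mapsto> a \<otimes> b\<close>, \<open>(t, c) \<mapsto> t \<otimes> c\<close> and \<open>(a, t) \<mapsto> a \<otimes> t\<close>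
  into \<open>B \<otimes> B\<close> and \<open>(B \<otimes> B) \<otimes> B = B \<otimes> (B \<otimes> B)\<close>, the last two algebras being identified by
  \<open>(a \<otimes> b) \<otimes> c = a \<otimes> (b \<otimes> c)\<close>. In the coassociativity condition \<open>L\<close> and \<open>R\<close> are \<open>\<Delta> \<otimes> id\<close> and \<open>id \<otimes> \<Delta>\<close>,
  the unique continuous linear maps with the stated values on simple tensors.

  The real span appearing in the density conditions (and in the definition of a continuous action)
  is the complex one, as the sets in question are closed under multiplication by complex scalars.
\<close>

definition compact_quantum_group ::
    "('b::unital_cstar_algebra \<Rightarrow> 'b \<Rightarrow> 'c::unital_cstar_algebra) \<Rightarrow>
     ('c \<Rightarrow> 'b \<Rightarrow> 'd::unital_cstar_algebra) \<Rightarrow> ('b \<Rightarrow> 'c \<Rightarrow> 'd) \<Rightarrow> ('b \<Rightarrow> 'c) \<Rightarrow> bool" where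
  "compact_quantum_group ten tenL tenR \<Delta> \<longleftrightarrow>
     is_spatial_tensor ten \<and> is_spatial_tensor tenL \<and> is_spatial_tensor tenR \<and>
     (\<forall>a b c. tenL (ten a b) c = tenR a (ten b c)) \<and>
     unital_star_hom \<Delta> \<and>
     (\<exists>L R. bounded_linear L \<and> (\<forall>a b. L (ten a b) = tenL (\<Delta> a) b) \<and>
            bounded_linear R \<and> (\<forall>a b. R (ten a b) = tenR a (\<Delta> b)) \<and>
            L \<circ> \<Delta> = R \<circ> \<Delta>) \<and>
     closure (span {\<Delta> a * ten 1 b | a b. True}) = UNIV \<and>
     closure (span {\<Delta> a * ten b 1 | a b. True}) = UNIV"

text \<open>The map \<open>\<Psi> \<otimes> id\<close>, sending \<open>e\<^sub>i\<^sub>j \<otimes> b\<close> to \<open>\<Psi>(e\<^sub>i\<^sub>j) \<otimes> b\<close>; the map \<open>id \<otimes> \<Delta>\<close> is \<^term>\<open>map_matrix \<Delta>\<close>.\<close>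

definition action_tensor_id ::
    "('b \<Rightarrow> 'b \<Rightarrow> 'c::unital_cstar_algebra) \<Rightarrow> (complex^2^2 \<Rightarrow> 'b^2^2) \<Rightarrow> 'b^2^2 \<Rightarrow> 'c^2^2" where
  "action_tensor_id ten \<Psi> A =
     (\<chi> k l. \<Sum>i\<in>UNIV. \<Sum>j\<in>UNIV. ten (\<Psi> (mat_unit i j) $ k $ l) (A $ i $ j))"

definition is_action ::
    "('b::unital_cstar_algebra \<Rightarrow> 'b \<Rightarrow> 'c::unital_cstar_algebra) \<Rightarrow> ('b \<Rightarrow> 'c) \<Rightarrow>
     (complex^2^2 \<Rightarrow> 'b^2^2) \<Rightarrow> bool" where
  "is_action ten \<Delta> \<Psi> \<longleftrightarrow>
     unital_star_hom_mat2 \<Psi> \<and> action_tensor_id ten \<Psi> \<circ> \<Psi> = map_matrix \<Delta> \<circ> \<Psi>"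

definition continuous_action :: "(complex^2^2 \<Rightarrow> 'b::unital_cstar_algebra^2^2) \<Rightarrow> bool" where
  "continuous_action \<Psi> \<longleftrightarrow> closure (span {\<Psi> m ** mat b | m b. True}) = UNIV"

definition preserves_state ::
    "(complex^2^2 \<Rightarrow> complex) \<Rightarrow> (complex^2^2 \<Rightarrow> 'b::unital_cstar_algebra^2^2) \<Rightarrow> bool" where
  "preserves_state \<omega> \<Psi> \<longleftrightarrow> (\<forall>m. slice \<omega> (\<Psi> m) = \<omega> m *\<^sub>C 1)"

end

theory Submission
  imports Defs "HOL-Complex_Analysis.Cauchy_Integral_Formula"
begin

text \<open>
  Let \<open>N = \<Psi>(n)\<close>. Invariance of the state fixes the upper left corner of \<open>\<Psi>(m)\<close> to be \<open>m\<^sub>1\<^sub>1\<close> for every \<open>m\<close>.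
  Applied to \<open>n\<close> and to \<open>n\<^sup>* n\<close> it makes the first column of \<open>N\<close> vanish, because the corner of \<open>N\<^sup>* N\<close> is
  the sum of \<open>N\<^sub>i\<^sub>1\<^sup>* N\<^sub>i\<^sub>1\<close>. So \<open>N\<close> has second column \<open>(b, d)\<close>, and the relations among matrix units
  (\<open>n\<^sup>2 = 0\<close> and \<open>n n\<^sup>* + n\<^sup>* n = 1\<close>) give \<open>b b\<^sup>* = 1\<close> and \<open>b d = b d\<^sup>* = 0\<close>. It remains to exclude a proper
  coisometry \<open>b\<close>. The lower left corner of \<open>\<Psi>(m)(1 \<otimes> x)\<close> is always in \<open>b\<^sup>* B\<close>, on which the projection
  \<open>b\<^sup>* b\<close> acts as the identity; the density that defines continuity of the action therefore forces
  \<open>b\<^sup>* b = 1\<close>, and then \<open>d = b\<^sup>* b d = 0\<close>. This is lemma \<open>continuous_state_preserving_nil_gen\<close>.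

  As the matrix algebra is generated by \<open>n\<close>, a homomorphism \<open>\<Gamma>\<close> satisfies the required equation iff it
  sends the generator \<open>u\<close> of \<open>C(\<T>)\<close> to the unitary \<open>b\<close>. The theorem thus becomes the universal property
  of \<open>C(\<T>)\<close>: every unitary is the image of \<open>u\<close> under exactly one unital *-homomorphism
  (\<open>unitary_functional_calculus\<close> and \<open>star_hom_circle_eqI\<close>).

  Uniqueness rests on the density of the trigonometric polynomials and on the contractivity of
  *-homomorphisms out of \<open>C(\<T>)\<close>. For existence one needs \<open>\<parallel>p(b)\<parallel> \<le> sup |p|\<close> over the circle for polynomials \<open>p\<close>
  (\<open>norm_poly_at_unitary_le\<close>). A crude estimate by the coefficients loses only a factor
  \<open>deg p + 1\<close>. Since \<open>p(b)\<close> is normal, the C*-identity yields \<open>\<parallel>p(b)\<parallel>\<^sup>m = \<parallel>p\<^sup>m(b)\<parallel>\<close> for \<open>m = 2\<^sup>k\<close>, and the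
  factor for \<open>p\<^sup>m\<close> grows only linearly in \<open>m\<close>, so it disappears in the limit.
\<close>

section \<open>Homomorphisms of C*-algebras\<close>

lemma adj_zero [simp]: "adj 0 = (0 :: 'a::unital_cstar_algebra)"
  by (rule linear_0[OF bounded_linear.linear[OF bounded_linear_adj]])

lemma scaleC_zero_right [simp]: "c *\<^sub>C 0 = (0 :: 'a::unital_cstar_algebra)"
  by (rule linear_0[OF bounded_linear.linear[OF bounded_linear_scaleC]])

lemma scaleC_minus_one: "(-1) *\<^sub>C x = - (x :: 'a::unital_cstar_algebra)"
  using scaleR_scaleC[of "-1" x] by simp

lemma unital_star_hom_zero: "unital_star_hom f \<Longrightarrow> f 0 = 0"
  unfolding unital_star_hom_def by (metis add_cancel_right_right add_0)

lemma norm_isometry: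
  assumes "adj v * v = 1"
  shows "norm (v :: 'a::unital_cstar_algebra) = 1"
  using cstar_identity[of v] assms norm_ge_zero[of v]
  by (auto simp: power2_eq_1_iff simp del: norm_ge_zero)

text \<open>
  The reason is that a self-adjoint function bounded by 1 is the real part of a unitary function,
  namely of \<open>f + i (1 - f\<^sup>2)\<^sup>1\<^sup>/\<^sup>2\<close>, and homomorphisms send unitaries to unitaries, which have norm 1.
  This avoids spectral theory in the target algebra.
\<close>

lemma star_hom_contractive_selfadjoint:
  fixes \<Gamma> :: "('x::metric_space \<Rightarrow>\<^sub>C complex) \<Rightarrow> 'b::unital_cstar_algebra"
  assumes \<Gamma>: "unital_star_hom \<Gamma>" and sa: "adj f = f" and le: "norm f \<le> 1"
  shows "norm (\<Gamma> f) \<le> 1"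
proof -
  have real: "complex_of_real (Re (f x)) = f x" for x
    using arg_cong[OF sa, of "\<lambda>h. apply_bcontfun h x"]
    by (simp add: adj_complex_def complex_eq_iff)
  have Re_le: "(Re (f x))\<^sup>2 \<le> 1" for x
    using norm_bounded[of f x] le abs_Re_le_cmod[of "f x"]
    by (simp add: abs_square_le_1)
  (* The function k is the imaginary part of the unitary v with real part f. *)
  define k where "k = (\<lambda>x. complex_of_real (sqrt (1 - (Re (f x))\<^sup>2)))"
  have "k \<in> bcontfun"
  proof (rule bcontfun_normI)
    show "continuous_on UNIV k"
      unfolding k_def using continuous_on_apply_bcontfun[of UNIV f]
      by (intro continuous_intros) auto
    show "norm (k x) \<le> 1" for x
      using Re_le[of x] by (simp add: k_def)
  qed
  then obtain g where g: "apply_bcontfun g = k"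
    by (metis Bcontfun_inverse)
  define v where "v = f + \<i> *\<^sub>C g"
  have v: "adj v * v = 1"
  proof (rule bcontfun_eqI)
    fix x
    have "cnj (f x) = f x"
      by (metis real complex_cnj_complex_of_real)
    moreover have "(f x)\<^sup>2 + (g x)\<^sup>2 = 1"
      using Re_le[of x] by (subst (1) real[symmetric]) (simp add: g k_def flip: of_real_power of_real_add)
    ultimately show "apply_bcontfun (adj v * v) x = apply_bcontfun 1 x"
      by (simp add: v_def adj_complex_def scaleC_complex_def g k_def algebra_simps power2_eq_square)
  qed
  have f: "f = (1/2) *\<^sub>C (v + adj v)"
    by (rule bcontfun_eqI, subst (1) real[symmetric])
      (simp add: v_def adj_complex_def scaleC_complex_def g k_def complex_eq_iff)
  have "adj (\<Gamma> v) * \<Gamma> v = 1"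
    using \<Gamma> v unfolding unital_star_hom_def by metis
  then have "norm (\<Gamma> v) = 1"
    by (rule norm_isometry)
  moreover have "\<Gamma> f = (1/2) *\<^sub>C (\<Gamma> v + adj (\<Gamma> v))"
    using \<Gamma> by (subst f) (simp add: unital_star_hom_def)
  ultimately show ?thesis
    using norm_triangle_ineq[of "\<Gamma> v" "adj (\<Gamma> v)"] by (simp add: norm_scaleC)
qed

text \<open>
  The C*-identity, applied in both algebras, reduces the bound to the self-adjoint element \<open>f\<^sup>* f\<close>.
\<close>

lemma star_hom_contractive:
  fixes \<Gamma> :: "('x::metric_space \<Rightarrow>\<^sub>C complex) \<Rightarrow> 'b::unital_cstar_algebra"
  assumes \<Gamma>: "unital_star_hom \<Gamma>"
  shows "norm (\<Gamma> f) \<le> norm f"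
proof -
  have sa: "norm (\<Gamma> h) \<le> norm h" if h: "adj h = h" for h :: "'x \<Rightarrow>\<^sub>C complex"
  proof (cases "h = 0")
    case True
    then show ?thesis by (simp add: unital_star_hom_zero[OF \<Gamma>])
  next
    case False
    define c where "c = complex_of_real (inverse (norm h))"
    have c: "cmod c = inverse (norm h)" "cnj c = c"
      by (simp_all add: c_def norm_inverse flip: of_real_inverse)
    have "norm (\<Gamma> (c *\<^sub>C h)) \<le> 1"
      by (rule star_hom_contractive_selfadjoint[OF \<Gamma>])
        (use False h in \<open>simp_all add: adj_scaleC norm_scaleC c\<close>)
    moreover have "\<Gamma> (c *\<^sub>C h) = c *\<^sub>C \<Gamma> h"
      using \<Gamma> unfolding unital_star_hom_def by blast
    ultimately show ?thesis
      using False by (simp add: norm_scaleC c field_simps)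
  qed
  have "(norm (\<Gamma> f))\<^sup>2 = norm (\<Gamma> (adj f * f))"
    using \<Gamma> unfolding unital_star_hom_def by (metis cstar_identity)
  also have "\<dots> \<le> (norm f)\<^sup>2"
    using sa[of "adj f * f"] by (simp add: adj_mult adj_adj cstar_identity)
  finally show ?thesis
    by (rule power2_le_imp_le) simp
qed

section \<open>Density of trigonometric polynomials\<close>

lemma compact_UNIV_circle: "compact (UNIV :: circle set)"
proof -
  have "continuous_on (sphere 0 1) Abs_circle"
    by (auto simp: continuous_on_iff dist_circle_def Abs_circle_inverse)
  then have "compact (Abs_circle ` sphere 0 1)"
    by (rule compact_continuous_image) simp
  moreover have "Abs_circle ` sphere 0 1 = UNIV"
    by (auto simp: image_def) (metis of_circle of_circle_inverse mem_sphere_0)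
  ultimately show ?thesis by simp
qed

text \<open>
  The density of the trigonometric polynomials, in the form of an induction rule: the functions with
  property \<open>P\<close> form a closed algebra that contains \<open>u\<close> and \<open>u\<^sup>*\<close>. The real-valued ones among them form
  an algebra that contains the two coordinate functions, so the real Stone-Weierstrass theorem applies
  to the real and the imaginary part of \<open>f\<close>.
\<close>

lemma circle_function_induct [case_names closed add mult scale gen adj_gen]:
  assumes closed: "closed {f. P f}"
    and add: "\<And>f g. P f \<Longrightarrow> P g \<Longrightarrow> P (f + g)"
    and mult: "\<And>f g. P f \<Longrightarrow> P g \<Longrightarrow> P (f * g)"
    and scale: "\<And>c f. P f \<Longrightarrow> P (c *\<^sub>C f)"
    and gen: "P circle_gen" and adj_gen: "P (adj circle_gen)"
  shows "P (f :: circle \<Rightarrow>\<^sub>C complex)"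
proof -
  have one: "P 1"
    using mult[OF gen adj_gen] by simp
  define R where "R = {g. \<exists>f. P f \<and> (\<forall>z. apply_bcontfun f z = complex_of_real (g z))}"
  have ReR: "(\<lambda>z. Re (of_circle z)) \<in> R"
    using scale[OF add[OF gen adj_gen], of "1/2"] unfolding R_def
    by (auto intro!: exI[of _ "(1/2) *\<^sub>C (circle_gen + adj circle_gen)"]
        simp: circle_gen.rep_eq scaleC_complex_def adj_complex_def complex_eq_iff)
  have ImR: "(\<lambda>z. Im (of_circle z)) \<in> R"
    using scale[OF add[OF gen scale[OF adj_gen, of "-1"]], of "-\<i>/2"] unfolding R_def
    by (auto intro!: exI[of _ "(-\<i>/2) *\<^sub>C (circle_gen + (-1) *\<^sub>C adj circle_gen)"]
        simp: circle_gen.rep_eq scaleC_complex_def adj_complex_def complex_eq_iff)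
  have ring: "function_ring_on R UNIV"
  proof
    show "compact (UNIV :: circle set)" by (rule compact_UNIV_circle)
  next
    fix g assume "g \<in> R"
    then obtain f where "\<And>z. apply_bcontfun f z = complex_of_real (g z)"
      by (auto simp: R_def)
    then have "g = (\<lambda>z. Re (apply_bcontfun f z))" by simp
    then show "continuous_on UNIV g"
      using continuous_on_apply_bcontfun[of UNIV f] by (auto intro: continuous_intros)
  next
    fix g h assume "g \<in> R" "h \<in> R"
    then obtain f k where "P f" "\<And>z. apply_bcontfun f z = complex_of_real (g z)"
      "P k" "\<And>z. apply_bcontfun k z = complex_of_real (h z)"
      by (auto simp: R_def)
    then have "P (f + k) \<and> (\<forall>z. apply_bcontfun (f + k) z = complex_of_real (g z + h z))"
      "P (f * k) \<and> (\<forall>z. apply_bcontfun (f * k) z = complex_of_real (g z * h z))"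
      by (simp_all add: add mult)
    then show "(\<lambda>x. g x + h x) \<in> R" "(\<lambda>x. g x * h x) \<in> R"
      unfolding R_def by blast+
  next
    show "(\<lambda>_. c) \<in> R" for c
      unfolding R_def using scale[OF one, of "complex_of_real c"]
      by (auto intro!: exI[of _ "complex_of_real c *\<^sub>C 1"] simp: scaleC_complex_def)
  next
    fix x y :: circle assume "x \<noteq> y"
    then have "Re (of_circle x) \<noteq> Re (of_circle y) \<or> Im (of_circle x) \<noteq> Im (of_circle y)"
      by (simp add: complex_eq_iff flip: of_circle_inject)
    then show "\<exists>g\<in>R. g x \<noteq> g y"
      using bexI[OF _ ReR, of "\<lambda>g. g x \<noteq> g y"] bexI[OF _ ImR, of "\<lambda>g. g x \<noteq> g y"] by argo
  qed
  have "f \<in> closure {f. P f}"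
    unfolding closure_approachable
  proof (intro allI impI)
    fix e :: real assume e: "e > 0"
    have cont: "continuous_on UNIV (\<lambda>z. Re (f z))" "continuous_on UNIV (\<lambda>z. Im (f z))"
      by (intro continuous_on_Re continuous_on_Im continuous_on_apply_bcontfun)+
    have e4: "e/4 > 0" using e by simp
    obtain g where g: "g \<in> R" "\<And>z. \<bar>Re (f z) - g z\<bar> < e/4"
      using function_ring_on.Stone_Weierstrass_basic[OF ring cont(1) e4] by blast
    obtain h where h: "h \<in> R" "\<And>z. \<bar>Im (f z) - h z\<bar> < e/4"
      using function_ring_on.Stone_Weierstrass_basic[OF ring cont(2) e4] by blast
    obtain g' where g': "P g'" "\<And>z. apply_bcontfun g' z = complex_of_real (g z)"
      using g(1) unfolding R_def by blast
    obtain h' where h': "P h'" "\<And>z. apply_bcontfun h' z = complex_of_real (h z)"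
      using h(1) unfolding R_def by blast
    have "norm (g' + \<i> *\<^sub>C h' - f) \<le> e/2"
    proof (rule norm_bound)
      fix z
      show "norm (apply_bcontfun (g' + \<i> *\<^sub>C h' - f) z) \<le> e/2"
        using cmod_le[of "apply_bcontfun (g' + \<i> *\<^sub>C h' - f) z"] g(2)[of z] h(2)[of z]
        by (simp add: g' h' scaleC_complex_def abs_minus_commute)
    qed
    with e have "dist (g' + \<i> *\<^sub>C h') f < e"
      by (simp add: dist_norm)
    then show "\<exists>y\<in>{f. P f}. dist y f < e"
      using add[OF g'(1) scale[OF h'(1)]] by blast
  qed
  with closed show ?thesis
    by (simp add: closure_closed)
qed

lemma star_hom_circle_eqI:
  fixes \<Gamma> \<Gamma>' :: "(circle \<Rightarrow>\<^sub>C complex) \<Rightarrow> 'b::unital_cstar_algebra"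
  assumes \<Gamma>: "unital_star_hom \<Gamma>" and \<Gamma>': "unital_star_hom \<Gamma>'"
    and eq: "\<Gamma> circle_gen = \<Gamma>' circle_gen"
  shows "\<Gamma> = \<Gamma>'"
proof
  have cont: "continuous_on UNIV K" if K: "unital_star_hom K"
    for K :: "(circle \<Rightarrow>\<^sub>C complex) \<Rightarrow> 'b"
  proof (rule linear_continuous_on, rule bounded_linear_intro[where K = 1])
    show "K (x + y) = K x + K y" for x y
      using K by (simp add: unital_star_hom_def)
    show "K (r *\<^sub>R x) = r *\<^sub>R K x" for r x
      using K by (simp add: unital_star_hom_def scaleR_scaleC)
    show "norm (K x) \<le> norm x * 1" for x
      using star_hom_contractive[OF K] by simp
  qed
  fix f show "\<Gamma> f = \<Gamma>' f"
  proof (induction f rule: circle_function_induct)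
    case closed
    show ?case by (intro closed_Collect_eq cont \<Gamma> \<Gamma>')
  qed (use \<Gamma> \<Gamma>' eq in \<open>simp_all add: unital_star_hom_def\<close>)
qed

section \<open>Polynomials in a unitary\<close>

definition poly_at :: "complex poly \<Rightarrow> 'a::unital_cstar_algebra \<Rightarrow> 'a" where
  "poly_at p x = fold_coeffs (\<lambda>a y. a *\<^sub>C 1 + x * y) p 0"

lemma poly_at_0 [simp]: "poly_at 0 x = 0"
  by (simp add: poly_at_def)

lemma poly_at_pCons [simp]: "poly_at (pCons a p) x = a *\<^sub>C 1 + x * poly_at p x"
  by (cases "p = 0 \<and> a = 0") (auto simp: poly_at_def scaleC_zero_left)

lemma poly_at_1 [simp]: "poly_at 1 x = 1"
  by (simp add: one_pCons scaleC_one)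

lemma poly_at_add [simp]: "poly_at (p + q) x = poly_at p x + poly_at q x"
  by (induction p q rule: poly_induct2) (simp_all add: algebra_simps scaleC_add_left)

lemma poly_at_smult [simp]: "poly_at (smult c p) x = c *\<^sub>C poly_at p x"
  by (induction p) (simp_all add: scaleC_add_right scaleC_scaleC mult_scaleC_right)

lemma poly_at_mult [simp]: "poly_at (p * q) x = poly_at p x * poly_at q x"
  by (induction p) (simp_all add: scaleC_zero_left algebra_simps mult_scaleC_left)

lemma poly_at_power [simp]: "poly_at (p ^ n) x = poly_at p x ^ n"
  by (induction n) simp_all

lemma poly_at_monom [simp]: "poly_at (monom 1 n) x = x ^ n"
  by (induction n) (simp_all add: monom_0 monom_Suc scaleC_zero_left scaleC_one)

lemma poly_at_commute:
  assumes "x * y = y * x"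
  shows "poly_at p x * y = y * poly_at p x"
proof (induction p)
  case (pCons a p)
  have "x * poly_at p x * y = y * (x * poly_at p x)"
    by (simp add: mult.assoc pCons.IH) (simp add: assms flip: mult.assoc)
  then show ?case
    by (simp add: algebra_simps mult_scaleC_left mult_scaleC_right)
qed simp

lemma poly_at_circle_gen: "apply_bcontfun (poly_at p circle_gen) z = poly p (of_circle z)"
  by (induction p) (simp_all add: circle_gen.rep_eq scaleC_complex_def)

lemma norm_poly_at_le_coeffs:
  assumes "norm x \<le> 1" and "\<And>i. cmod (coeff p i) \<le> M"
  shows "norm (poly_at p x) \<le> M * (degree p + 1)"
  using assms(2)
proof (induction p)
  case 0
  then show ?case by simp
next
  case (pCons a p)
  have a: "cmod a \<le> M" using pCons.prems[of 0] by simp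
  have "norm (x * poly_at p x) \<le> 1 * norm (poly_at p x)"
    using norm_mult_ineq[of x "poly_at p x"] assms(1)
    by (meson mult_right_mono norm_ge_zero order_trans)
  then have "norm (poly_at (pCons a p) x) \<le> M + norm (poly_at p x)"
    using a norm_triangle_ineq[of "a *\<^sub>C 1" "x * poly_at p x"] by (simp add: norm_scaleC)
  moreover have "norm (poly_at p x) \<le> M * (degree p + 1)"
    using pCons.IH pCons.prems[of "Suc _"] by simp
  ultimately show ?case
    using a by (cases "p = 0") (auto simp: algebra_simps)
qed

text \<open>
  Cauchy's estimate for the Taylor coefficients at 0.
\<close>

lemma coeff_le_on_circle:
  fixes p :: "complex poly"
  assumes "\<And>z. cmod z = 1 \<Longrightarrow> cmod (poly p z) \<le> s"
  shows "cmod (coeff p n) \<le> s"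
proof -
  have deriv: "(deriv ^^ n) (poly p) = poly ((pderiv ^^ n) p)"
  proof (induction n)
    case (Suc n)
    then show ?case
      by (auto intro!: DERIV_imp_deriv poly_DERIV)
  qed simp
  have "norm ((deriv ^^ n) (poly p) 0) \<le> fact n * s / 1 ^ n"
    by (rule Cauchy_inequality) (use assms in \<open>auto intro: holomorphic_intros continuous_intros\<close>)
  moreover have "(deriv ^^ n) (poly p) 0 = fact n * coeff p n"
    by (simp add: deriv poly_0_coeff_0 coeff_higher_pderiv pochhammer_fact add.commute)
  ultimately show ?thesis
    by (simp add: norm_mult)
qed

text \<open>
  For normal \<open>y\<close>, \<open>\<parallel>y\<^sup>2\<parallel>\<^sup>2 = \<parallel>(y\<^sup>* y)\<^sup>* (y\<^sup>* y)\<parallel> = \<parallel>y\<parallel>\<^sup>4\<close>; squaring repeatedly reaches the exponents \<open>2\<^sup>k\<close>.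
\<close>

lemma norm_power_normal:
  fixes x :: "'a::unital_cstar_algebra"
  assumes "adj x * x = x * adj x"
  shows "norm (x ^ 2 ^ k) = norm x ^ 2 ^ k"
proof -
  have sq: "norm (y * y) = norm y ^ 2" if y: "adj y * y = y * adj y" for y :: 'a
  proof -
    have "norm (y * y) ^ 2 = norm (adj (adj y * y) * (adj y * y))"
      by (simp add: adj_mult adj_adj mult.assoc flip: cstar_identity) (metis mult.assoc y)
    also have "\<dots> = (norm y ^ 2) ^ 2"
      by (simp add: cstar_identity)
    finally show ?thesis
      by (rule power2_eq_imp_eq) simp_all
  qed
  have normal: "adj (x ^ n) * x ^ n = x ^ n * adj (x ^ n)" for n
  proof -
    have adj_power: "adj (x ^ m) = adj x ^ m" for m
      by (induction m) (simp_all add: adj_mult power_commutes)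
    show ?thesis
      unfolding adj_power using assms
      by (metis power_commuting_commutes)
  qed
  show ?thesis
  proof (induction k)
    case (Suc k)
    have "x ^ 2 ^ Suc k = x ^ 2 ^ k * x ^ 2 ^ k"
      by (simp add: mult_2 power_add)
    then show ?case
      using sq[OF normal] Suc by (simp add: power_mult power2_eq_square mult_2 power_add)
  qed simp
qed

text \<open>
  A factor that grows linearly in the exponent \<open>m = 2\<^sup>k\<close> cannot make up for the decay of \<open>(s/r)\<^sup>m\<close>.
\<close>

lemma le_if_dyadic_powers_le:
  fixes r s C :: real
  assumes "0 \<le> r" "0 \<le> s" and le: "\<And>k. r ^ 2 ^ k \<le> s ^ 2 ^ k * (C * 2 ^ k + 1)"
  shows "r \<le> s"
proof (rule ccontr)
  assume "\<not> r \<le> s"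
  then have rs: "s < r" by simp
  let ?q = "s / r"
  have q: "norm ?q < 1" "0 \<le> ?q" using rs assms(1,2) by auto
  have "(\<lambda>n. C * (real n * ?q ^ n) + ?q ^ n) \<longlonglongrightarrow> C * 0 + 0"
    by (intro tendsto_intros powser_times_n_limit_0 LIMSEQ_power_zero) (use q in auto)
  then have "\<forall>\<^sub>F n in sequentially. C * (real n * ?q ^ n) + ?q ^ n < 1"
    by (rule order_tendstoD) simp
  then obtain n0 where n0: "\<And>n. n \<ge> n0 \<Longrightarrow> C * (real n * ?q ^ n) + ?q ^ n < 1"
    by (auto simp: eventually_sequentially)
  let ?n = "2 ^ n0 :: nat"
  have "r ^ ?n > 0" using rs assms by simp
  then have "1 \<le> ?q ^ ?n * (C * ?n + 1)"
    using le[of n0] by (simp add: power_divide field_simps)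
  moreover have "?n \<ge> n0" by (simp add: less_imp_le)
  ultimately show False
    using n0[of ?n] by (simp add: algebra_simps)
qed

text \<open>
  The von Neumann inequality for a unitary. The powers of \<open>p\<close> have supremum at most \<open>s\<^sup>m\<close> on the circle
  and degree at most \<open>m deg p\<close>, so estimating the coefficients of \<open>p\<^sup>m\<close> gives
  \<open>\<parallel>p(b)\<parallel>\<^sup>m \<le> s\<^sup>m (m deg p + 1)\<close> for the exponents \<open>m = 2\<^sup>k\<close>.
\<close>

lemma norm_poly_at_unitary_le:
  fixes b :: "'a::unital_cstar_algebra"
  assumes b: "adj b * b = 1" "b * adj b = 1"
    and s: "\<And>z. cmod z = 1 \<Longrightarrow> cmod (poly p z) \<le> s"
  shows "norm (poly_at p b) \<le> s"
proof (rule le_if_dyadic_powers_le)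
  have s0: "0 \<le> s" using s[of 1] norm_ge_zero[of "poly p 1"] by (simp del: norm_ge_zero)
  then show "0 \<le> s" .
  (* Normality of p(b): it commutes with b*, hence its adjoint commutes with b, hence with p(b). *)
  have "poly_at p b * adj b = adj b * poly_at p b"
    by (rule poly_at_commute) (simp add: b)
  then have "adj (poly_at p b * adj b) = adj (adj b * poly_at p b)"
    by simp
  then have "b * adj (poly_at p b) = adj (poly_at p b) * b"
    by (simp add: adj_mult adj_adj)
  then have normal: "adj (poly_at p b) * poly_at p b = poly_at p b * adj (poly_at p b)"
    by (metis poly_at_commute)
  fix k :: nat
  let ?m = "2 ^ k :: nat"
  have "norm (poly_at p b) ^ ?m = norm (poly_at (p ^ ?m) b)"
    by (simp add: norm_power_normal[OF normal])
  also have "\<dots> \<le> s ^ ?m * (degree (p ^ ?m) + 1)"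
  proof (rule norm_poly_at_le_coeffs)
    show "norm b \<le> 1" using norm_isometry[OF b(1)] by simp
    show "cmod (coeff (p ^ ?m) i) \<le> s ^ ?m" for i
      by (rule coeff_le_on_circle) (simp add: poly_power norm_power power_mono s)
  qed
  also have "\<dots> \<le> s ^ ?m * (real (degree p) * 2 ^ k + 1)"
  proof -
    have "real (degree (p ^ ?m)) \<le> real (degree p * ?m)"
      by (rule of_nat_mono[OF degree_power_le])
    then show ?thesis
      using s0 by (intro mult_left_mono) simp_all
  qed
  finally show "norm (poly_at p b) ^ ?m \<le> s ^ ?m * (real (degree p) * 2 ^ k + 1)" .
qed simp

section \<open>Continuous functional calculus for a unitary\<close>

text \<open>
  For unitary \<open>v\<close> this says \<open>x = v\<^sup>-\<^sup>N p(v)\<close>, so that \<open>x\<close> is the value at \<open>v\<close> of a Laurent polynomial.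
  Clearing the denominator keeps everything in terms of ordinary polynomials.
\<close>

definition laurent_value :: "nat \<Rightarrow> complex poly \<Rightarrow> 'a::unital_cstar_algebra \<Rightarrow> 'a \<Rightarrow> bool" where
  "laurent_value N p v x \<longleftrightarrow> v ^ N * x = poly_at p v"

lemma laurent_value_add:
  assumes "laurent_value N p v x" "laurent_value M q v y"
  shows "laurent_value (N + M) (monom 1 M * p + monom 1 N * q) v (x + y)"
proof -
  have "v ^ (N + M) = v ^ M * v ^ N"
    by (metis add.commute power_add)
  then have "v ^ (N + M) * x = v ^ M * poly_at p v"
    using assms(1) by (simp add: laurent_value_def mult.assoc)
  moreover have "v ^ (N + M) * y = v ^ N * poly_at q v"
    using assms(2) by (simp add: laurent_value_def mult.assoc power_add)
  ultimately show ?thesis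
    by (simp add: laurent_value_def distrib_left)
qed

lemma laurent_value_mult:
  assumes "laurent_value N p v x" "laurent_value M q v y"
  shows "laurent_value (N + M) (p * q) v (x * y)"
proof -
  have "v ^ (N + M) * (x * y) = v ^ M * (v ^ N * x) * y"
    by (metis add.commute mult.assoc power_add)
  also have "\<dots> = poly_at p v * v ^ M * y"
    using assms(1) poly_at_commute[of v "v ^ M" p]
    by (simp add: laurent_value_def power_commutes)
  finally show ?thesis
    using assms(2) by (simp add: laurent_value_def mult.assoc)
qed

lemma laurent_value_scaleC:
  "laurent_value N p v x \<Longrightarrow> laurent_value N (smult c p) v (c *\<^sub>C x)"
  by (simp add: laurent_value_def mult_scaleC_right)

text \<open>
  The graph of \<open>q(u) \<mapsto> q(b)\<close> for Laurent polynomials \<open>q\<close>. Its closure turns out to be the graph of the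
  functional calculus. Working with pairs, the algebraic laws need no choice of a representation \<open>(N, p)\<close>,
  and single-valuedness is a consequence of the norm bound.
\<close>

definition laurent_graph :: "'b::unital_cstar_algebra \<Rightarrow> ((circle \<Rightarrow>\<^sub>C complex) \<times> 'b) set" where
  "laurent_graph b = {(f, y). \<exists>N p. laurent_value N p circle_gen f \<and> laurent_value N p b y}"

lemma laurent_graph_one: "(1, 1) \<in> laurent_graph b"
  unfolding laurent_graph_def laurent_value_def
  by (auto intro!: exI[of _ 0] exI[of _ "1 :: complex poly"])

lemma laurent_graph_gen: "(circle_gen, b) \<in> laurent_graph b"
  unfolding laurent_graph_def laurent_value_def
  by (auto intro!: exI[of _ 0] exI[of _ "[:0, 1:]"] simp: scaleC_one scaleC_zero_left)

lemma laurent_graph_adj_gen: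
  "b * adj b = 1 \<Longrightarrow> (adj circle_gen, adj b) \<in> laurent_graph b"
  unfolding laurent_graph_def laurent_value_def
  by (auto intro!: exI[of _ 1] exI[of _ "1 :: complex poly"])

lemma laurent_graph_add:
  "(f, y) \<in> laurent_graph b \<Longrightarrow> (g, z) \<in> laurent_graph b \<Longrightarrow> (f + g, y + z) \<in> laurent_graph b"
  unfolding laurent_graph_def by clarify (blast intro: laurent_value_add)

lemma laurent_graph_mult:
  "(f, y) \<in> laurent_graph b \<Longrightarrow> (g, z) \<in> laurent_graph b \<Longrightarrow> (f * g, y * z) \<in> laurent_graph b"
  unfolding laurent_graph_def by clarify (blast intro: laurent_value_mult)

lemma laurent_graph_scaleC:
  "(f, y) \<in> laurent_graph b \<Longrightarrow> (c *\<^sub>C f, c *\<^sub>C y) \<in> laurent_graph b"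
  unfolding laurent_graph_def by clarify (blast intro: laurent_value_scaleC)

text \<open>
  Multiplication by \<open>b\<^sup>N\<close> or \<open>u\<^sup>N\<close> preserves the norm, which reduces the claim to polynomials, where
  \<open>\<parallel>p(u)\<parallel>\<close> is the supremum of \<open>|p|\<close> on the circle.
\<close>

lemma laurent_graph_norm_le:
  fixes b :: "'b::unital_cstar_algebra"
  assumes b: "adj b * b = 1" "b * adj b = 1" and fy: "(f, y) \<in> laurent_graph b"
  shows "norm y \<le> norm f"
proof -
  obtain N p where p: "circle_gen ^ N * f = poly_at p circle_gen" "b ^ N * y = poly_at p b"
    using fy by (auto simp: laurent_graph_def laurent_value_def)
  have "adj b ^ N * b ^ N = 1"
  proof (induction N)
    case (Suc N)
    have "adj b ^ Suc N * b ^ Suc N = adj b ^ N * (adj b * b) * b ^ N"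
      by (simp only: power_Suc2[of "adj b"] power_Suc[of b] mult.assoc)
    with Suc b show ?case by simp
  qed simp
  then have "y = adj b ^ N * poly_at p b"
    by (simp flip: p(2) mult.assoc)
  then have "norm y \<le> norm (adj b ^ N) * norm (poly_at p b)"
    by (simp add: norm_mult_ineq)
  also have "\<dots> \<le> 1 * norm (poly_at p b)"
    using norm_power_ineq[of "adj b" N] norm_isometry[OF b(1)]
    by (intro mult_right_mono) simp_all
  also have "norm (poly_at p b) \<le> norm (poly_at p circle_gen)"
  proof (rule norm_poly_at_unitary_le[OF b])
    fix z :: complex assume "cmod z = 1"
    then show "cmod (poly p z) \<le> norm (poly_at p circle_gen)"
      using norm_bounded[of "poly_at p circle_gen" "Abs_circle z"]
      by (simp add: poly_at_circle_gen Abs_circle_inverse)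
  qed
  also have "\<dots> \<le> norm (circle_gen ^ N) * norm f"
    by (simp add: norm_mult_ineq flip: p(1))
  also have "\<dots> \<le> 1 * norm f"
    using norm_power_ineq[of circle_gen N] norm_isometry[of circle_gen]
    by (intro mult_right_mono) simp_all
  finally show ?thesis by simp
qed

lemma closure_binary_closed:
  assumes "\<And>x y. x \<in> S \<Longrightarrow> y \<in> S \<Longrightarrow> h x y \<in> S"
    and cont: "continuous_on UNIV (\<lambda>p. h (fst p) (snd p))"
    and "x \<in> closure S" "y \<in> closure S"
  shows "h x y \<in> closure S"
proof -
  have "(\<lambda>p. h (fst p) (snd p)) ` closure (S \<times> S) \<subseteq> closure S"
    by (rule image_closure_subset)
      (use assms(1) closure_subset[of S] in \<open>auto intro: continuous_on_subset[OF cont]\<close>)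
  then show ?thesis
    using assms(3,4) by (force simp: closure_Times)
qed

text \<open>
  The closed graph inherits the algebraic laws and the bound \<open>\<parallel>y\<parallel> \<le> \<parallel>f\<parallel>\<close> from Laurent polynomials. By the
  bound it is single-valued, and its domain is closed because values along a convergent sequence form a
  Cauchy sequence. The domain is then all of \<open>C(\<T>)\<close> by density.
\<close>

lemma unitary_functional_calculus:
  fixes b :: "'b::unital_cstar_algebra"
  assumes b: "adj b * b = 1" "b * adj b = 1"
  shows "\<exists>\<Gamma> :: (circle \<Rightarrow>\<^sub>C complex) \<Rightarrow> 'b. unital_star_hom \<Gamma> \<and> \<Gamma> circle_gen = b"
proof -
  define G where "G = closure (laurent_graph b)"
  have base: "(circle_gen, b) \<in> G" "(adj circle_gen, adj b) \<in> G" "(1, 1) \<in> G"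
    using closure_subset[of "laurent_graph b"] laurent_graph_gen laurent_graph_adj_gen[OF b(2)]
      laurent_graph_one unfolding G_def by blast+
  have add: "(f + g, y + z) \<in> G" if "(f, y) \<in> G" "(g, z) \<in> G" for f g y z
  proof -
    have "(fst (f, y) + fst (g, z), snd (f, y) + snd (g, z)) \<in> closure (laurent_graph b)"
      by (rule closure_binary_closed[where h = "\<lambda>s t. (fst s + fst t, snd s + snd t)"])
        (use that in \<open>auto simp: G_def laurent_graph_add intro!: continuous_on_Pair
          continuous_on_add continuous_on_fst continuous_on_snd continuous_on_id\<close>)
    then show ?thesis by (simp add: G_def)
  qed
  have mult: "(f * g, y * z) \<in> G" if "(f, y) \<in> G" "(g, z) \<in> G" for f g y z
  proof -
    have "(fst (f, y) * fst (g, z), snd (f, y) * snd (g, z)) \<in> closure (laurent_graph b)"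
      by (rule closure_binary_closed[where h = "\<lambda>s t. (fst s * fst t, snd s * snd t)"])
        (use that in \<open>auto simp: G_def laurent_graph_mult intro!: continuous_on_Pair
          continuous_on_mult continuous_on_fst continuous_on_snd continuous_on_id\<close>)
    then show ?thesis by (simp add: G_def)
  qed
  have scale: "(c *\<^sub>C f, c *\<^sub>C y) \<in> G" if "(f, y) \<in> G" for c f y
  proof -
    have "(c *\<^sub>C fst (f, y), c *\<^sub>C snd (f, y)) \<in> closure (laurent_graph b)"
      by (rule closure_binary_closed[where h = "\<lambda>s t. (c *\<^sub>C fst s, c *\<^sub>C snd s)"])
        (use that in \<open>auto simp: G_def laurent_graph_scaleC intro!: continuous_on_Pair
          bounded_linear.continuous_on[OF bounded_linear_scaleC]
          continuous_on_fst continuous_on_snd continuous_on_id\<close>)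
    then show ?thesis by (simp add: G_def)
  qed
  have norm_le: "norm y \<le> norm f" if "(f, y) \<in> G" for f y
  proof -
    have "G \<subseteq> {s. norm (snd s) \<le> norm (fst s)}"
      unfolding G_def
    proof (rule closure_minimal)
      show "laurent_graph b \<subseteq> {s. norm (snd s) \<le> norm (fst s)}"
        using laurent_graph_norm_le[OF b] by auto
    qed (intro closed_Collect_le continuous_intros)
    with that show ?thesis by auto
  qed
  have diff: "norm (y - z) \<le> norm (f - g)" if "(f, y) \<in> G" "(g, z) \<in> G" for f g y z
    using norm_le[OF add[OF that(1) scale[OF that(2), of "-1"]]] by (simp add: scaleC_minus_one)
  have total: "\<exists>y. (f, y) \<in> G" for f
  proof (induction f rule: circle_function_induct)
    case closed
    show ?case
      unfolding closed_sequential_limits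
    proof (intro allI impI)
      fix F f assume "(\<forall>n. F n \<in> {f. \<exists>y. (f, y) \<in> G}) \<and> F \<longlonglongrightarrow> f"
      then obtain Y where Y: "\<And>n. (F n, Y n) \<in> G" and F: "F \<longlonglongrightarrow> f"
        by simp metis
      have "Cauchy Y"
        unfolding Cauchy_def
      proof (intro allI impI)
        fix e :: real assume "e > 0"
        then obtain M where "\<And>m n. m \<ge> M \<Longrightarrow> n \<ge> M \<Longrightarrow> dist (F m) (F n) < e"
          using LIMSEQ_imp_Cauchy[OF F] unfolding Cauchy_def by meson
        then show "\<exists>M. \<forall>m\<ge>M. \<forall>n\<ge>M. dist (Y m) (Y n) < e"
          using diff[OF Y Y] unfolding dist_norm by (meson le_less_trans)
      qed
      then obtain y where "Y \<longlonglongrightarrow> y"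
        using Cauchy_convergent_iff convergent_def by blast
      then have "(\<lambda>n. (F n, Y n)) \<longlonglongrightarrow> (f, y)"
        by (intro tendsto_Pair F)
      then have "(f, y) \<in> G"
        using closed_sequentially[of G "\<lambda>n. (F n, Y n)"] Y by (simp add: G_def)
      then show "f \<in> {f. \<exists>y. (f, y) \<in> G}" by blast
    qed
  qed (use base add mult scale in blast)+
  define \<Gamma> where "\<Gamma> f = (SOME y. (f, y) \<in> G)" for f
  have graph: "(f, \<Gamma> f) \<in> G" for f
    unfolding \<Gamma>_def by (rule someI_ex[OF total])
  have eq: "\<Gamma> f = y" if "(f, y) \<in> G" for f y
    using diff[OF graph[of f] that] by simp
  have \<Gamma>_add: "\<Gamma> (f + g) = \<Gamma> f + \<Gamma> g" for f g
    by (rule eq[OF add[OF graph graph]])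
  have \<Gamma>_scale: "\<Gamma> (c *\<^sub>C f) = c *\<^sub>C \<Gamma> f" for c f
    by (rule eq[OF scale[OF graph]])
  have \<Gamma>_mult: "\<Gamma> (f * g) = \<Gamma> f * \<Gamma> g" for f g
    by (rule eq[OF mult[OF graph graph]])
  have bl: "bounded_linear \<Gamma>"
    by (rule bounded_linear_intro[where K = 1])
      (simp_all add: \<Gamma>_add \<Gamma>_scale scaleR_scaleC norm_le[OF graph])
  (* The graph was not built from adjoints, so compatibility with them needs a density argument. *)
  have "\<Gamma> (adj f) = adj (\<Gamma> f)" for f
  proof (induction f rule: circle_function_induct)
    case closed
    show ?case
      by (intro closed_Collect_eq linear_continuous_on bounded_linear_compose[OF bl bounded_linear_adj]
          bounded_linear_compose[OF bounded_linear_adj bl])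
  next
    case gen
    show ?case using eq[OF base(1)] eq[OF base(2)] by simp
  next
    case adj_gen
    show ?case using eq[OF base(1)] eq[OF base(2)] by (simp add: adj_adj)
  qed (simp_all add: adj_add adj_mult adj_scaleC \<Gamma>_add \<Gamma>_mult \<Gamma>_scale)
  then have "unital_star_hom \<Gamma>"
    by (simp add: unital_star_hom_def \<Gamma>_add \<Gamma>_scale \<Gamma>_mult eq[OF base(3)])
  then show ?thesis
    using eq[OF base(1)] by blast
qed

section \<open>Actions on two by two matrices\<close>

text \<open>
  The matrix units are \<open>n n\<^sup>*\<close>, \<open>n\<close>, \<open>n\<^sup>*\<close> and \<open>n\<^sup>* n\<close>, so homomorphisms are determined by their value at \<open>n\<close>.
\<close>

lemma mat2_unit_decomposition:
  fixes m :: "complex^2^2"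
  shows "m = map_matrix (scaleC (m$1$1)) (nil_gen ** madj nil_gen)
    + map_matrix (scaleC (m$1$2)) nil_gen
    + map_matrix (scaleC (m$2$1)) (madj nil_gen)
    + map_matrix (scaleC (m$2$2)) (madj nil_gen ** nil_gen)"
  by (simp add: mat2_eq_iff nil_gen_def madj_def matrix_matrix_mult_def sum_2
      scaleC_complex_def adj_complex_def)

lemma unital_star_hom_mat2_expand:
  assumes F: "unital_star_hom_mat2 F"
  shows "F m = map_matrix (scaleC (m$1$1)) (F nil_gen ** madj (F nil_gen))
    + map_matrix (scaleC (m$1$2)) (F nil_gen)
    + map_matrix (scaleC (m$2$1)) (madj (F nil_gen))
    + map_matrix (scaleC (m$2$2)) (madj (F nil_gen) ** F nil_gen)"
proof -
  have hom: "F (A + B) = F A + F B" "F (map_matrix (scaleC c) A) = map_matrix (scaleC c) (F A)"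
    "F (A ** B) = F A ** F B" "F (madj A) = madj (F A)" for A B c
    using F by (simp_all add: unital_star_hom_mat2_def)
  show ?thesis
    by (subst mat2_unit_decomposition[of m]) (simp only: hom)
qed

lemma unital_star_hom_mat2_map_matrix:
  fixes \<Gamma> :: "'a::unital_cstar_algebra \<Rightarrow> 'b::unital_cstar_algebra"
  assumes \<Gamma>: "unital_star_hom \<Gamma>" and F: "unital_star_hom_mat2 F"
  shows "unital_star_hom_mat2 (map_matrix \<Gamma> \<circ> F)"
proof -
  have "map_matrix \<Gamma> (A + B) = map_matrix \<Gamma> A + map_matrix \<Gamma> B"
    "map_matrix \<Gamma> (map_matrix (scaleC c) A) = map_matrix (scaleC c) (map_matrix \<Gamma> A)"
    "map_matrix \<Gamma> (A ** B) = map_matrix \<Gamma> A ** map_matrix \<Gamma> B"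
    "map_matrix \<Gamma> (madj A) = madj (map_matrix \<Gamma> A)"
    "map_matrix \<Gamma> (mat 1) = (mat 1 :: 'b^2^2)" for A B c
    using \<Gamma> unital_star_hom_zero[OF \<Gamma>] unfolding unital_star_hom_def
    by (simp_all add: mat2_eq_iff matrix_matrix_mult_def sum_2 madj_def mat_def)
  with F show ?thesis
    by (simp add: unital_star_hom_mat2_def)
qed

lemma map_matrix_\<Psi>0_eq_iff:
  assumes \<Gamma>: "unital_star_hom \<Gamma>" and \<Psi>: "unital_star_hom_mat2 \<Psi>"
    and gen: "\<Psi> nil_gen = mat2 0 b 0 0"
  shows "map_matrix \<Gamma> \<circ> \<Psi>0 = \<Psi> \<longleftrightarrow> \<Gamma> circle_gen = b"
proof
  assume "map_matrix \<Gamma> \<circ> \<Psi>0 = \<Psi>"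
  then have "map_matrix \<Gamma> (\<Psi>0 nil_gen) $ 1 $ 2 = \<Psi> nil_gen $ 1 $ 2"
    by (metis comp_apply)
  then show "\<Gamma> circle_gen = b"
    by (simp add: \<Psi>0_nil_gen gen)
next
  assume "\<Gamma> circle_gen = b"
  then have eq: "(map_matrix \<Gamma> \<circ> \<Psi>0) nil_gen = \<Psi> nil_gen"
    by (simp add: \<Psi>0_nil_gen gen mat2_eq_iff unital_star_hom_zero[OF \<Gamma>])
  have hom: "unital_star_hom_mat2 (map_matrix \<Gamma> \<circ> \<Psi>0)"
    by (rule unital_star_hom_mat2_map_matrix[OF \<Gamma> unital_star_hom_mat2_\<Psi>0])
  show "map_matrix \<Gamma> \<circ> \<Psi>0 = \<Psi>"
  proof
    show "(map_matrix \<Gamma> \<circ> \<Psi>0) m = \<Psi> m" for m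
      unfolding unital_star_hom_mat2_expand[OF hom, of m] unital_star_hom_mat2_expand[OF \<Psi>, of m]
      by (simp only: eq)
  qed
qed

lemma slice_\<omega>0: "slice \<omega>0 A = A $ 1 $ 1"
  by (simp add: slice_def sum_2 \<omega>0_def mat_unit_def axis_def scaleC_one scaleC_zero_left)

lemma eq_zero_if_adj_mult_self_eq_zero:
  "adj x * x = 0 \<Longrightarrow> x = (0 :: 'a::unital_cstar_algebra)"
  using cstar_identity[of x] by simp

text \<open>
  Each relation comes from one entry of an identity between matrix units, using that the upper left
  corner of \<open>\<Psi>(m)\<close> is known for all \<open>m\<close>. The second column \<open>(b, d)\<close> is not yet determined: \<open>b\<close> could be a proper
  coisometry and \<open>d\<close> a nilpotent living under the complement of \<open>b\<^sup>* b\<close>.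
\<close>

lemma state_preserving_hom_nil_gen:
  fixes \<Psi> :: "complex^2^2 \<Rightarrow> 'b::unital_cstar_algebra^2^2"
  assumes \<Psi>: "unital_star_hom_mat2 \<Psi>" and pres: "preserves_state \<omega>0 \<Psi>"
  obtains b d where "\<Psi> nil_gen = mat2 0 b 0 d" "b * adj b = 1" "b * d = 0" "b * adj d = 0"
proof -
  let ?N = "\<Psi> nil_gen"
  define b d where "b = ?N $ 1 $ 2" and "d = ?N $ 2 $ 2"
  have corner: "\<Psi> m $ 1 $ 1 = (m $ 1 $ 1) *\<^sub>C 1" for m
    using pres by (simp add: preserves_state_def slice_\<omega>0) (simp add: \<omega>0_def)
  have hom: "\<Psi> (A ** B) = \<Psi> A ** \<Psi> B" "\<Psi> (madj A) = madj (\<Psi> A)" for A B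
    using \<Psi> by (simp_all add: unital_star_hom_mat2_def)
  have a: "?N $ 1 $ 1 = 0"
    by (simp add: corner) (simp add: nil_gen_def scaleC_zero_left)
  have "(madj ?N ** ?N) $ 1 $ 1 = 0"
    unfolding hom[symmetric] corner
    by (simp add: nil_gen_def madj_def matrix_matrix_mult_def sum_2 scaleC_zero_left)
  then have "adj (?N $ 2 $ 1) * ?N $ 2 $ 1 = 0"
    by (simp add: a madj_def matrix_matrix_mult_def sum_2)
  then have c: "?N $ 2 $ 1 = 0"
    by (rule eq_zero_if_adj_mult_self_eq_zero)
  have "(?N ** madj ?N) $ 1 $ 1 = 1"
    unfolding hom[symmetric] corner
    by (simp add: nil_gen_def madj_def matrix_matrix_mult_def sum_2 scaleC_one adj_complex_def)
  then have bb: "b * adj b = 1"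
    by (simp add: a b_def madj_def matrix_matrix_mult_def sum_2)
  (* The zero matrix is written as a scalar multiple, since linearity of \<Psi> gives its value there. *)
  have "?N ** ?N = \<Psi> (map_matrix (scaleC 0) nil_gen)"
    unfolding hom[symmetric]
    by (rule arg_cong[of _ _ \<Psi>])
      (simp add: mat2_eq_iff nil_gen_def matrix_matrix_mult_def sum_2 scaleC_zero_left)
  also have "\<dots> = map_matrix (scaleC 0) ?N"
    using \<Psi> by (simp add: unital_star_hom_mat2_def)
  finally have "(?N ** ?N) $ 1 $ 2 = 0"
    by (simp add: scaleC_zero_left)
  then have bd: "b * d = 0"
    by (simp add: a b_def d_def matrix_matrix_mult_def sum_2)
  have "?N ** madj ?N + madj ?N ** ?N = \<Psi> (nil_gen ** madj nil_gen + madj nil_gen ** nil_gen)"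
    using \<Psi> by (simp add: unital_star_hom_mat2_def)
  also have "nil_gen ** madj nil_gen + madj nil_gen ** nil_gen = mat 1"
    by (simp add: mat2_eq_iff nil_gen_def madj_def matrix_matrix_mult_def sum_2 mat_def
        adj_complex_def)
  also have "\<Psi> (mat 1) = mat 1"
    using \<Psi> by (simp add: unital_star_hom_mat2_def)
  finally have "(?N ** madj ?N + madj ?N ** ?N) $ 1 $ 2 = 0"
    by (simp add: mat_def)
  then have bd': "b * adj d = 0"
    by (simp add: a c b_def d_def madj_def matrix_matrix_mult_def sum_2)
  have "?N = mat2 0 b 0 d"
    by (simp add: mat2_eq_iff a c b_def d_def)
  with bb bd bd' show ?thesis using that by blast
qed

text \<open>
  Continuity of the action makes \<open>b\<close> injective: all lower left corners of \<open>\<Psi>(m)(1 \<otimes> x)\<close> are in the range of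
  the projection \<open>b\<^sup>* b\<close>, which is a closed condition, while 1 is a limit of sums of such corners.
\<close>

lemma continuous_state_preserving_nil_gen:
  fixes \<Psi> :: "complex^2^2 \<Rightarrow> 'b::unital_cstar_algebra^2^2"
  assumes \<Psi>: "unital_star_hom_mat2 \<Psi>" and cont: "continuous_action \<Psi>"
    and pres: "preserves_state \<omega>0 \<Psi>"
  obtains b where "\<Psi> nil_gen = mat2 0 b 0 0" "adj b * b = 1" "b * adj b = 1"
proof -
  obtain b d where N: "\<Psi> nil_gen = mat2 0 b 0 d" and b: "b * adj b = 1"
    and bd: "b * d = 0" "b * adj d = 0"
    by (rule state_preserving_hom_nil_gen[OF \<Psi> pres])
  have db: "d * adj b = 0"
    using arg_cong[OF bd(2), of adj] by (simp add: adj_mult adj_adj)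
  define S where "S = {A :: 'b^2^2. adj b * b * A $ 2 $ 1 = A $ 2 $ 1}"
  have "span {\<Psi> m ** mat x | m x. True} \<subseteq> S"
  proof (rule span_minimal)
    show "{\<Psi> m ** mat x | m x. True} \<subseteq> S"
    proof clarify
      fix m x
      have "\<Psi> m $ 2 $ 1 = (m $ 2 $ 1) *\<^sub>C adj b"
        by (subst unital_star_hom_mat2_expand[OF \<Psi>])
          (simp add: N madj_def matrix_matrix_mult_def sum_2 db)
      then have "(\<Psi> m ** mat x) $ 2 $ 1 = (m $ 2 $ 1) *\<^sub>C (adj b * x)"
        by (simp add: matrix_matrix_mult_def sum_2 mat_def mult_scaleC_left)
      moreover have "adj b * b * (adj b * x) = adj b * (b * adj b) * x"
        by (simp add: mult.assoc)
      ultimately show "\<Psi> m ** mat x \<in> S"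
        by (simp add: S_def mult_scaleC_right b)
    qed
    show "subspace S"
      by (auto simp: S_def subspace_def algebra_simps)
  qed
  moreover have "closed S"
    unfolding S_def by (intro closed_Collect_eq continuous_intros)
  ultimately have "closure (span {\<Psi> m ** mat x | m x. True}) \<subseteq> S"
    by (rule closure_minimal)
  then have "mat2 0 0 1 0 \<in> S"
    using cont unfolding continuous_action_def by blast
  then have bb: "adj b * b = 1"
    by (simp add: S_def)
  then have "d = adj b * (b * d)"
    by (simp flip: mult.assoc)
  then have "d = 0"
    by (simp add: bd)
  with N b bb show ?thesis using that by blast
qed

theorem theorem5p6:
  fixes ten :: "'b::unital_cstar_algebra \<Rightarrow> 'b \<Rightarrow> 'c::unital_cstar_algebra"
    and tenL :: "'c \<Rightarrow> 'b \<Rightarrow> 'd::unital_cstar_algebra"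
    and tenR :: "'b \<Rightarrow> 'c \<Rightarrow> 'd"
    and \<Delta> :: "'b \<Rightarrow> 'c"
    and \<Psi> :: "complex^2^2 \<Rightarrow> 'b^2^2"
  assumes "compact_quantum_group ten tenL tenR \<Delta>"
    and "is_action ten \<Delta> \<Psi>"
    and "continuous_action \<Psi>"
    and "preserves_state \<omega>0 \<Psi>"
  shows "\<exists>!\<Gamma> :: (circle \<Rightarrow>\<^sub>C complex) \<Rightarrow> 'b.
           unital_star_hom \<Gamma> \<and> map_matrix \<Gamma> \<circ> \<Psi>0 = \<Psi>"
proof -
  have \<Psi>: "unital_star_hom_mat2 \<Psi>"
    using assms(2) by (simp add: is_action_def)
  obtain b where N: "\<Psi> nil_gen = mat2 0 b 0 0" and b: "adj b * b = 1" "b * adj b = 1"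
    by (rule continuous_state_preserving_nil_gen[OF \<Psi> assms(3,4)])
  obtain \<Gamma> :: "(circle \<Rightarrow>\<^sub>C complex) \<Rightarrow> 'b" where "unital_star_hom \<Gamma>" "\<Gamma> circle_gen = b"
    using unitary_functional_calculus[OF b] by blast
  then show ?thesis
    using map_matrix_\<Psi>0_eq_iff[OF _ \<Psi> N] star_hom_circle_eqI by metis
qed

end
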